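(* Let $n=2$, $T\in\mathbb{N}_+$, $\delta\le1/6$, $\epsilon\le2^{-(T+1)}$, and let $A\in\widetilde{\mathcal{A}}$. Then there exists $\nu\in\mathcal{P}$ such that with probability at least $1/6$, $$\frac{\widetilde N_T}{H(\nu)}\ge\frac{\sigma^2}{192}\log\!\Big(\frac{1}{2\delta}\Big)\epsilon^{-\frac{2}{T}}.$$
   Context: Setting: a bandit model is $\nu=(\nu_1,\dots,\nu_n)$ with each $\nu_i$ a $\sigma$-sub-Gaussian distribution with mean in $[0,1]$; $\mathcal{P}$ is the set of such models (including Gaussian arms $\mathcal{N}(\mu,\sigma^2)$). Arm $[j]$ has the $j$-th highest mean; $\Delta_i=\mu_{[1]}-\mu_i$ ($i\ne[1]$), $\Delta_{[1]}=\mu_{[1]}-\mu_{[2]}$; $N_i^*=\epsilon^{-2}$ if $\Delta_i<\epsilon$, else $(\Delta_i+\epsilon)^{-2}$; $H(\nu)=\sum_iN_i^*$. A $T$-round algorithm chooses at each round $t$ integers $N_{i,t}\ge0$ measurably in the past, observes $N_{i,t}$ fresh i.i.d. samples from each $\nu_i$, and outputs $\hat I$ after round $T$; $\widetilde N_T=\sum_i\sum_{t\le T}N_{i,t}$. It is $(\epsilon,\delta)$-PAC if for all $\nu\in\mathcal{P}$, $\mathbb{P}_{A,\nu}(\mu_{\hat I}>\mu_{[1]}-\epsilon)\ge1-\delta$. $\widetilde{\mathcal{A}}$ is the class of $(\epsilon,\delta)$-PAC $T$-round algorithms that fix numbers $\{Q_{i,t}\}_{i\in[n],t\in[T]}$ in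 advance (independent of observations) and satisfy $N_{i,t}\in\{0,Q_{i,t}\}$ for all $i,t$, the choice between $0$ and $Q_{i,t}$ being adaptive. *)

theory Defs
  imports "HOL-Probability.Probability"
begin

text \<open>Arms are indexed by naturals i < n; a bandit model is nu :: nat => real measure,
  only the entries i < n matter.\<close>

definition arm_mean :: "real measure \<Rightarrow> real" where
  "arm_mean M = integral\<^sup>L M (\<lambda>x. x)"

definition subgaussian :: "real \<Rightarrow> real measure \<Rightarrow> bool" where
  "subgaussian \<sigma> M \<longleftrightarrow> prob_space M \<and> sets M = sets borel \<and> integrable M (\<lambda>x. x) \<and>
     (\<forall>l::real. integrable M (\<lambda>x. exp (l * (x - arm_mean M))) \<and>
        integral\<^sup>L M (\<lambda>x. exp (l * (x - arm_mean M))) \<le> exp (l\<^sup>2 * \<sigma>\<^sup>2 / 2))"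

definition bandit_models :: "nat \<Rightarrow> real \<Rightarrow> (nat \<Rightarrow> real measure) set" where
  "bandit_models n \<sigma> = {nu. \<forall>i<n. subgaussian \<sigma> (nu i) \<and> arm_mean (nu i) \<in> {0..1}}"

definition best_mean :: "nat \<Rightarrow> (nat \<Rightarrow> real measure) \<Rightarrow> real" where
  "best_mean n nu = Max ((\<lambda>i. arm_mean (nu i)) ` {..<n})"

text \<open>Gap Delta_i: mu_[1] - mu_i for a suboptimal arm, mu_[1] - mu_[2] for the best arm
  (ties at the top give gap 0, independent of tie-breaking).\<close>
definition gap :: "nat \<Rightarrow> (nat \<Rightarrow> real measure) \<Rightarrow> nat \<Rightarrow> real" where
  "gap n nu i =
     (if arm_mean (nu i) < best_mean n nu then best_mean n nu - arm_mean (nu i)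
      else best_mean n nu - Max ((\<lambda>j. arm_mean (nu j)) ` ({..<n} - {i})))"

definition Nstar :: "nat \<Rightarrow> real \<Rightarrow> (nat \<Rightarrow> real measure) \<Rightarrow> nat \<Rightarrow> real" where
  "Nstar n \<epsilon> nu i = (if gap n nu i < \<epsilon> then 1 / \<epsilon>\<^sup>2 else 1 / (gap n nu i + \<epsilon>)\<^sup>2)"

definition Hcomp :: "nat \<Rightarrow> real \<Rightarrow> (nat \<Rightarrow> real measure) \<Rightarrow> real" where
  "Hcomp n \<epsilon> nu = (\<Sum>i<n. Nstar n \<epsilon> nu i)"

text \<open>Rounds are t = 0..T-1. Since at round t arm i is sampled either 0 or Q i t times,
  the samples X_(i,t,k), k < Q i t, are drawn up front (i.i.d. from nu i, all independent);
  the algorithm only observes those of the rounds/arms it actually chooses.\<close>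
definition sample_index :: "nat \<Rightarrow> nat \<Rightarrow> (nat \<Rightarrow> nat \<Rightarrow> nat) \<Rightarrow> (nat \<times> nat \<times> nat) set" where
  "sample_index n T Q = {(i, t, k). i < n \<and> t < T \<and> k < Q i t}"

definition sample_space ::
  "nat \<Rightarrow> nat \<Rightarrow> (nat \<Rightarrow> nat \<Rightarrow> nat) \<Rightarrow> (nat \<Rightarrow> real measure) \<Rightarrow> (nat \<times> nat \<times> nat \<Rightarrow> real) measure" where
  "sample_space n T Q nu = PiM (sample_index n T Q) (\<lambda>(i, t, k). nu i)"

definition borel_sample_space ::
  "nat \<Rightarrow> nat \<Rightarrow> (nat \<Rightarrow> nat \<Rightarrow> nat) \<Rightarrow> (nat \<times> nat \<times> nat \<Rightarrow> real) measure" where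
  "borel_sample_space n T Q = PiM (sample_index n T Q) (\<lambda>_. (borel :: real measure))"

text \<open>b i t w: whether arm i is sampled (Q i t times) in round t; Ihat w: output arm.
  observed_agree n Q b t w w': w and w' agree on all samples observed (under w) before round t.\<close>
definition observed_agree ::
  "nat \<Rightarrow> (nat \<Rightarrow> nat \<Rightarrow> nat) \<Rightarrow> (nat \<Rightarrow> nat \<Rightarrow> (nat \<times> nat \<times> nat \<Rightarrow> real) \<Rightarrow> bool) \<Rightarrow> nat
    \<Rightarrow> (nat \<times> nat \<times> nat \<Rightarrow> real) \<Rightarrow> (nat \<times> nat \<times> nat \<Rightarrow> real) \<Rightarrow> bool" where
  "observed_agree n Q b t w w' \<longleftrightarrow>
     (\<forall>j s k. j < n \<and> s < t \<and> b j s w \<and> k < Q j s \<longrightarrow> w (j, s, k) = w' (j, s, k))"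

definition fixed_batch_alg ::
  "nat \<Rightarrow> nat \<Rightarrow> (nat \<Rightarrow> nat \<Rightarrow> nat) \<Rightarrow> (nat \<Rightarrow> nat \<Rightarrow> (nat \<times> nat \<times> nat \<Rightarrow> real) \<Rightarrow> bool)
    \<Rightarrow> ((nat \<times> nat \<times> nat \<Rightarrow> real) \<Rightarrow> nat) \<Rightarrow> bool" where
  "fixed_batch_alg n T Q b Ihat \<longleftrightarrow>
     (\<forall>i<n. \<forall>t<T. b i t \<in> measurable (borel_sample_space n T Q) (count_space UNIV) \<and>
        (\<forall>w\<in>space (borel_sample_space n T Q). \<forall>w'\<in>space (borel_sample_space n T Q).
           observed_agree n Q b t w w' \<longrightarrow> b i t w = b i t w')) \<and>
     Ihat \<in> measurable (borel_sample_space n T Q) (count_space UNIV) \<and>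
     (\<forall>w\<in>space (borel_sample_space n T Q). Ihat w < n) \<and>
     (\<forall>w\<in>space (borel_sample_space n T Q). \<forall>w'\<in>space (borel_sample_space n T Q).
        observed_agree n Q b T w w' \<longrightarrow> Ihat w = Ihat w')"

definition is_PAC ::
  "nat \<Rightarrow> nat \<Rightarrow> (nat \<Rightarrow> nat \<Rightarrow> nat) \<Rightarrow> ((nat \<times> nat \<times> nat \<Rightarrow> real) \<Rightarrow> nat)
    \<Rightarrow> real \<Rightarrow> real \<Rightarrow> real \<Rightarrow> bool" where
  "is_PAC n T Q Ihat \<sigma> \<epsilon> \<delta> \<longleftrightarrow>
     (\<forall>nu\<in>bandit_models n \<sigma>.
        measure (sample_space n T Q nu)
          {w \<in> space (sample_space n T Q nu). arm_mean (nu (Ihat w)) > best_mean n nu - \<epsilon>}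
        \<ge> 1 - \<delta>)"

definition A_tilde ::
  "nat \<Rightarrow> nat \<Rightarrow> real \<Rightarrow> real \<Rightarrow> real \<Rightarrow> (nat \<Rightarrow> nat \<Rightarrow> nat)
    \<Rightarrow> (nat \<Rightarrow> nat \<Rightarrow> (nat \<times> nat \<times> nat \<Rightarrow> real) \<Rightarrow> bool) \<Rightarrow> ((nat \<times> nat \<times> nat \<Rightarrow> real) \<Rightarrow> nat) \<Rightarrow> bool" where
  "A_tilde n T \<sigma> \<epsilon> \<delta> Q b Ihat \<longleftrightarrow> fixed_batch_alg n T Q b Ihat \<and> is_PAC n T Q Ihat \<sigma> \<epsilon> \<delta>"

definition Ntilde ::
  "nat \<Rightarrow> nat \<Rightarrow> (nat \<Rightarrow> nat \<Rightarrow> nat) \<Rightarrow> (nat \<Rightarrow> nat \<Rightarrow> (nat \<times> nat \<times> nat \<Rightarrow> real) \<Rightarrow> bool)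
    \<Rightarrow> (nat \<times> nat \<times> nat \<Rightarrow> real) \<Rightarrow> real" where
  "Ntilde n T Q b w = (\<Sum>i<n. \<Sum>t<T. if b i t w then real (Q i t) else 0)"

end

theory Submission
  imports Defs
begin

text \<open>
  Take Gaussian arms with means \<open>x\<close> and \<open>\<epsilon>\<close>, where \<open>x\<close> runs through \<open>q\<^sup>k\<close> for \<open>k = 0, \<dots>, T\<close> with
  \<open>q = (2\<epsilon>)\<^bsup>1/T\<^esup> \<le> 1/2\<close>; then the complexity is \<open>2 / x\<^sup>2\<close>. Replacing \<open>x\<close> by 0 changes the correct answer,
  so at each of these \<open>T + 1\<close> scales arm 0 needs about \<open>\<sigma>\<^sup>2 log (1/(2\<delta>)) / x\<^sup>2\<close> samples. If the claim
  fails, then at scale \<open>k\<close> the algorithm typically stays below a small multiple of what scale \<open>k + 1\<close>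
  needs. Collecting the rounds in which arm 0 is sampled in one suitable outcome per scale, the batches
  found up to scale \<open>k\<close> have a geometrically dominated total that is insufficient at scale \<open>k + 1\<close>,
  so every scale contributes a new round: \<open>T + 1\<close> rounds out of \<open>T\<close>.
\<close>

lemma PiM_density:
  fixes g :: "'i \<Rightarrow> 'a \<Rightarrow> ennreal"
  assumes "finite J"
    and M: "\<And>i. prob_space (M i)"
    and D: "\<And>i. prob_space (density (M i) (g i))"
    and g [measurable]: "\<And>i. g i \<in> borel_measurable (M i)"
  shows "PiM J (\<lambda>i. density (M i) (g i)) = density (PiM J M) (\<lambda>x. \<Prod>i\<in>J. g i (x i))"
proof -
  interpret M: product_prob_space M
    unfolding product_prob_space_def product_prob_space_axioms_def product_sigma_finite_def
    by (auto simp: M prob_space_imp_sigma_finite)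
  interpret D: product_prob_space "\<lambda>i. density (M i) (g i)"
    unfolding product_prob_space_def product_prob_space_axioms_def product_sigma_finite_def
    by (auto simp: D prob_space_imp_sigma_finite)
  have "density (PiM J M) (\<lambda>x. \<Prod>i\<in>J. g i (x i)) = PiM J (\<lambda>i. density (M i) (g i))"
  proof (rule D.PiM_eqI)
    show "finite J" by fact
    show "sets (density (PiM J M) (\<lambda>x. \<Prod>i\<in>J. g i (x i))) = sets (PiM J (\<lambda>i. density (M i) (g i)))"
      by (simp cong: sets_PiM_cong)
    fix A assume A: "\<And>i. i \<in> J \<Longrightarrow> A i \<in> sets (density (M i) (g i))"
    have A' [measurable]: "\<And>i. i \<in> J \<Longrightarrow> A i \<in> sets (M i)"
      using A by simp
    have box: "PiE J A \<in> sets (PiM J M)"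
      using \<open>finite J\<close> A' by (auto intro: sets_PiM_I_finite)
    have "emeasure (density (PiM J M) (\<lambda>x. \<Prod>i\<in>J. g i (x i))) (PiE J A) =
        (\<integral>\<^sup>+x. (\<Prod>i\<in>J. g i (x i)) * indicator (PiE J A) x \<partial>PiM J M)"
      by (rule emeasure_density) (use box in measurable)
    also have "\<dots> = (\<integral>\<^sup>+x. (\<Prod>i\<in>J. g i (x i) * indicator (A i) (x i)) \<partial>PiM J M)"
    proof (intro nn_integral_cong)
      fix x assume x: "x \<in> space (PiM J M)"
      have "(indicator (PiE J A) x :: ennreal) = (\<Prod>i\<in>J. indicator (A i) (x i))"
        using x \<open>finite J\<close> by (auto simp: indicator_def space_PiM PiE_iff prod_zero_iff)
      then show "(\<Prod>i\<in>J. g i (x i)) * indicator (PiE J A) x =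
          (\<Prod>i\<in>J. g i (x i) * indicator (A i) (x i))"
        by (simp add: prod.distrib)
    qed
    also have "\<dots> = (\<Prod>i\<in>J. \<integral>\<^sup>+x. g i x * indicator (A i) x \<partial>M i)"
      by (rule M.product_nn_integral_prod[OF \<open>finite J\<close>]) measurable
    also have "\<dots> = (\<Prod>i\<in>J. emeasure (density (M i) (g i)) (A i))"
      by (intro prod.cong refl) (simp add: emeasure_density)
    finally show "emeasure (density (PiM J M) (\<lambda>x. \<Prod>i\<in>J. g i (x i))) (PiE J A) =
        (\<Prod>i\<in>J. emeasure (density (M i) (g i)) (A i))" .
  qed
  then show ?thesis by simp
qed

definition gaussian :: "real \<Rightarrow> real \<Rightarrow> real measure" where
  "gaussian \<sigma> m = density lborel (\<lambda>x. ennreal (normal_density m \<sigma> x))"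

lemma sets_gaussian [simp, measurable_cong]: "sets (gaussian \<sigma> m) = sets borel"
  by (simp add: gaussian_def)

lemma prob_space_gaussian: "0 < \<sigma> \<Longrightarrow> prob_space (gaussian \<sigma> m)"
  unfolding gaussian_def by (rule prob_space_normal_density)

lemma exp_mult_normal_density:
  assumes "0 < \<sigma>"
  shows "normal_density m \<sigma> x * exp (l * (x - m)) =
    exp (l\<^sup>2 * \<sigma>\<^sup>2 / 2) * normal_density (m + l * \<sigma>\<^sup>2) \<sigma> x"
proof -
  have "- (x - m)\<^sup>2 / (2 * \<sigma>\<^sup>2) + l * (x - m) =
      l\<^sup>2 * \<sigma>\<^sup>2 / 2 + - (x - (m + l * \<sigma>\<^sup>2))\<^sup>2 / (2 * \<sigma>\<^sup>2)"
    using assms by (simp add: field_simps power2_eq_square)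
  then show ?thesis
    by (simp add: normal_density_def exp_add [symmetric])
qed

lemma integrable_gaussian_exp:
  assumes "0 < \<sigma>"
  shows "integrable (gaussian \<sigma> m) (\<lambda>x. exp (l * (x - m)))"
  using assms unfolding gaussian_def
  by (subst integrable_real_density) (auto simp: exp_mult_normal_density)

lemma integral_gaussian_exp:
  assumes "0 < \<sigma>"
  shows "integral\<^sup>L (gaussian \<sigma> m) (\<lambda>x. exp (l * (x - m))) = exp (l\<^sup>2 * \<sigma>\<^sup>2 / 2)"
  using assms unfolding gaussian_def
  by (subst integral_real_density) (auto simp: exp_mult_normal_density)

lemma integrable_gaussian_id: "0 < \<sigma> \<Longrightarrow> integrable (gaussian \<sigma> m) (\<lambda>x. x)"
  unfolding gaussian_def
  by (subst integrable_real_density) (auto simp: integrable_normal_moment_nz_1)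

lemma arm_mean_gaussian [simp]: "0 < \<sigma> \<Longrightarrow> arm_mean (gaussian \<sigma> m) = m"
  unfolding arm_mean_def gaussian_def
  by (subst integral_real_density) (auto simp: integral_normal_moment_nz_1)

lemma subgaussian_gaussian: "0 < \<sigma> \<Longrightarrow> subgaussian \<sigma> (gaussian \<sigma> m)"
  by (simp add: subgaussian_def prob_space_gaussian integrable_gaussian_id
      integrable_gaussian_exp integral_gaussian_exp)

definition gaussian_ratio :: "real \<Rightarrow> real \<Rightarrow> real \<Rightarrow> real \<Rightarrow> real" where
  "gaussian_ratio \<sigma> m m' x =
     exp ((m' - m) / \<sigma>\<^sup>2 * (x - m) - (m' - m)\<^sup>2 / (2 * \<sigma>\<^sup>2))"

lemma borel_measurable_gaussian_ratio [measurable]: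
  "gaussian_ratio \<sigma> m m' \<in> borel_measurable borel"
  unfolding gaussian_ratio_def by measurable

lemma gaussian_eq_density:
  assumes "0 < \<sigma>"
  shows "gaussian \<sigma> m' = density (gaussian \<sigma> m) (\<lambda>x. ennreal (gaussian_ratio \<sigma> m m' x))"
proof -
  have "normal_density m \<sigma> x * gaussian_ratio \<sigma> m m' x = normal_density m' \<sigma> x" for x
  proof -
    have "gaussian_ratio \<sigma> m m' x =
        exp ((m' - m) / \<sigma>\<^sup>2 * (x - m)) / exp (((m' - m) / \<sigma>\<^sup>2)\<^sup>2 * \<sigma>\<^sup>2 / 2)"
      using assms by (simp add: gaussian_ratio_def exp_diff power2_eq_square)
    then show ?thesis
      using exp_mult_normal_density[OF assms, of m x "(m' - m) / \<sigma>\<^sup>2"] assms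
      by (simp add: mult.commute)
  qed
  then show ?thesis
    unfolding gaussian_def
    by (subst density_density_eq) (auto simp: ennreal_mult' [symmetric] gaussian_ratio_def)
qed

lemma nn_integral_gaussian_ratio_sq:
  assumes "0 < \<sigma>"
  shows "(\<integral>\<^sup>+x. ennreal ((gaussian_ratio \<sigma> m m' x)\<^sup>2) \<partial>gaussian \<sigma> m) =
    ennreal (exp ((m' - m)\<^sup>2 / \<sigma>\<^sup>2))"
proof -
  let ?l = "2 * (m' - m) / \<sigma>\<^sup>2"
  have eq: "(gaussian_ratio \<sigma> m m' x)\<^sup>2 = exp (- ((m' - m)\<^sup>2 / \<sigma>\<^sup>2)) * exp (?l * (x - m))" for x
    using assms by (simp add: gaussian_ratio_def exp_add [symmetric] power2_eq_square field_simps)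
  have sq: "?l\<^sup>2 * \<sigma>\<^sup>2 / 2 = 2 * ((m' - m)\<^sup>2 / \<sigma>\<^sup>2)"
    using assms by (simp add: field_simps power2_eq_square)
  have "(\<integral>x. (gaussian_ratio \<sigma> m m' x)\<^sup>2 \<partial>gaussian \<sigma> m) =
      exp (- ((m' - m)\<^sup>2 / \<sigma>\<^sup>2)) * exp (2 * ((m' - m)\<^sup>2 / \<sigma>\<^sup>2))"
    unfolding eq sq [symmetric] integral_gaussian_exp[OF assms, of m ?l, symmetric]
    by (rule integral_mult_right_zero)
  also have "\<dots> = exp ((m' - m)\<^sup>2 / \<sigma>\<^sup>2)"
    unfolding exp_add [symmetric] by simp
  moreover have "integrable (gaussian \<sigma> m) (\<lambda>x. (gaussian_ratio \<sigma> m m' x)\<^sup>2)"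
    unfolding eq by (intro integrable_mult_right integrable_gaussian_exp assms)
  ultimately show ?thesis
    by (subst nn_integral_eq_integral) auto
qed

lemma gaussian_PiM_change_of_measure:
  fixes m m' :: "'i \<Rightarrow> real"
  assumes "finite J" and \<sigma>: "0 < \<sigma>" and s: "0 < s"
    and A [measurable]: "A \<in> sets (PiM J (\<lambda>_. borel))"
  shows "measure (PiM J (\<lambda>i. gaussian \<sigma> (m' i))) A \<le>
    s / 2 * measure (PiM J (\<lambda>i. gaussian \<sigma> (m i))) A +
    exp (\<Sum>i\<in>J. (m' i - m i)\<^sup>2 / \<sigma>\<^sup>2) / (2 * s)"
proof -
  define M where "M i = gaussian \<sigma> (m i)" for i
  define g where "g i = gaussian_ratio \<sigma> (m i) (m' i)" for i
  define F where "F x = (\<Prod>i\<in>J. g i (x i))" for x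
  interpret M: product_prob_space M
    unfolding product_prob_space_def product_prob_space_axioms_def product_sigma_finite_def
    by (auto simp: M_def prob_space_gaussian \<sigma> prob_space_imp_sigma_finite)
  interpret P: prob_space "PiM J M"
    by (intro prob_space_PiM) (simp add: M_def prob_space_gaussian \<sigma>)
  interpret P': prob_space "PiM J (\<lambda>i. gaussian \<sigma> (m' i))"
    by (intro prob_space_PiM) (simp add: prob_space_gaussian \<sigma>)
  have sets_M [measurable_cong]: "sets (M i) = sets borel" for i
    by (simp add: M_def)
  have sets_P [measurable_cong]: "sets (PiM J M) = sets (PiM J (\<lambda>_. borel))"
    by (intro sets_PiM_cong) (simp_all add: sets_M)
  have g [measurable]: "g i \<in> borel_measurable borel" for i
    by (simp add: g_def)
  have g_nonneg: "0 \<le> g i x" for i x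
    by (simp add: g_def gaussian_ratio_def)
  have F_nonneg: "0 \<le> F x" for x
    by (simp add: F_def g_nonneg prod_nonneg)
  have F [measurable]: "F \<in> borel_measurable (PiM J M)"
    unfolding F_def by measurable
  have "PiM J (\<lambda>i. gaussian \<sigma> (m' i)) = PiM J (\<lambda>i. density (M i) (\<lambda>x. ennreal (g i x)))"
    by (intro PiM_cong refl) (simp add: M_def g_def gaussian_eq_density[OF \<sigma>, symmetric])
  also have "\<dots> = density (PiM J M) (\<lambda>x. \<Prod>i\<in>J. ennreal (g i (x i)))"
    by (intro PiM_density \<open>finite J\<close>)
      (auto simp: M_def g_def gaussian_eq_density[OF \<sigma>, symmetric] prob_space_gaussian \<sigma>)
  finally have dens: "PiM J (\<lambda>i. gaussian \<sigma> (m' i)) = density (PiM J M) (\<lambda>x. ennreal (F x))"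
    by (simp add: F_def prod_ennreal g_nonneg)
  have F_sq: "(\<integral>\<^sup>+x. ennreal ((F x)\<^sup>2) \<partial>PiM J M) = ennreal (exp (\<Sum>i\<in>J. (m' i - m i)\<^sup>2 / \<sigma>\<^sup>2))"
  proof -
    have "(\<integral>\<^sup>+x. ennreal ((F x)\<^sup>2) \<partial>PiM J M) =
        (\<integral>\<^sup>+x. (\<Prod>i\<in>J. ennreal ((g i (x i))\<^sup>2)) \<partial>PiM J M)"
      by (simp add: F_def prod_ennreal prod_power_distrib)
    also have "\<dots> = (\<Prod>i\<in>J. \<integral>\<^sup>+x. ennreal ((g i x)\<^sup>2) \<partial>M i)"
      by (rule M.product_nn_integral_prod[OF \<open>finite J\<close>]) measurable
    also have "\<dots> = (\<Prod>i\<in>J. ennreal (exp ((m' i - m i)\<^sup>2 / \<sigma>\<^sup>2)))"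
      by (simp add: M_def g_def nn_integral_gaussian_ratio_sq \<sigma>)
    finally show ?thesis
      by (simp add: prod_ennreal exp_sum \<open>finite J\<close>)
  qed
  have "emeasure (PiM J (\<lambda>i. gaussian \<sigma> (m' i))) A = (\<integral>\<^sup>+x. ennreal (F x) * indicator A x \<partial>PiM J M)"
    unfolding dens by (rule emeasure_density) (measurable)
  also have "\<dots> \<le> (\<integral>\<^sup>+x. ennreal (s / 2) * indicator A x + ennreal (1 / (2 * s)) * ennreal ((F x)\<^sup>2) \<partial>PiM J M)"
  proof (intro nn_integral_mono)
    fix x
    have "0 \<le> (F x - s)\<^sup>2" by simp
    then have "F x \<le> s / 2 + 1 / (2 * s) * (F x)\<^sup>2"
      using s by (simp add: field_simps power2_eq_square)
    then have "ennreal (F x) \<le> ennreal (s / 2) + ennreal (1 / (2 * s)) * ennreal ((F x)\<^sup>2)"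
      using s by (simp add: ennreal_mult' [symmetric] ennreal_plus [symmetric] ennreal_leI del: ennreal_plus)
    then show "ennreal (F x) * indicator A x \<le>
        ennreal (s / 2) * indicator A x + ennreal (1 / (2 * s)) * ennreal ((F x)\<^sup>2)"
      by (auto simp: indicator_def)
  qed
  also have "\<dots> = ennreal (s / 2) * emeasure (PiM J M) A +
      ennreal (1 / (2 * s)) * ennreal (exp (\<Sum>i\<in>J. (m' i - m i)\<^sup>2 / \<sigma>\<^sup>2))"
    by (subst nn_integral_add) (auto simp: nn_integral_cmult F_sq nn_integral_cmult_indicator sets_P)
  also have "\<dots> = ennreal (s / 2 * measure (PiM J M) A +
      exp (\<Sum>i\<in>J. (m' i - m i)\<^sup>2 / \<sigma>\<^sup>2) / (2 * s))"
    using s by (simp add: P.emeasure_eq_measure ennreal_mult' [symmetric] ennreal_plus [symmetric] del: ennreal_plus)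
  finally show ?thesis
    unfolding P'.emeasure_eq_measure M_def using s by (subst (asm) ennreal_le_iff) simp_all
qed

lemma measure_PiM_cylinder:
  assumes "finite I" "J \<subseteq> I" and M: "\<And>i. prob_space (M i)" "\<And>i. sets (M i) = sets N"
    and A: "A \<in> sets (PiM I (\<lambda>_. N))" and c: "c \<in> space N"
    and dep: "\<And>w w'. w \<in> A \<Longrightarrow> w' \<in> space (PiM I (\<lambda>_. N)) \<Longrightarrow> (\<And>i. i \<in> J \<Longrightarrow> w i = w' i) \<Longrightarrow> w' \<in> A"
  defines "B \<equiv> {v \<in> space (PiM J (\<lambda>_. N)). (\<lambda>i\<in>I. if i \<in> J then v i else c) \<in> A}"
  shows "B \<in> sets (PiM J (\<lambda>_. N))" and "measure (PiM I M) A = measure (PiM J M) B"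
proof -
  interpret M: product_prob_space M
    unfolding product_prob_space_def product_prob_space_axioms_def product_sigma_finite_def
    by (auto simp: M prob_space_imp_sigma_finite)
  have [measurable]: "(\<lambda>v. \<lambda>i\<in>I. if i \<in> J then v i else c) \<in> PiM J (\<lambda>_. N) \<rightarrow>\<^sub>M PiM I (\<lambda>_. N)"
  proof (rule measurable_restrict)
    show "(\<lambda>v. if i \<in> J then v i else c) \<in> PiM J (\<lambda>_. N) \<rightarrow>\<^sub>M N" for i
      using c by (cases "i \<in> J") (auto intro: measurable_component_singleton)
  qed
  show B: "B \<in> sets (PiM J (\<lambda>_. N))"
    using A unfolding B_def by measurable
  have sp: "space (M i) = space N" for i
    using M(2) by (rule sets_eq_imp_space_eq)
  have "prod_emb I M J B = A"
  proof -
    have ext: "(\<lambda>i\<in>I. if i \<in> J then restrict w J i else c) \<in> space (PiM I (\<lambda>_. N))"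
      if "w \<in> space (PiM I (\<lambda>_. N))" for w
      using that c \<open>J \<subseteq> I\<close> by (auto simp: space_PiM PiE_iff)
    have "w \<in> A \<longleftrightarrow> (\<lambda>i\<in>I. if i \<in> J then restrict w J i else c) \<in> A"
      if w: "w \<in> space (PiM I (\<lambda>_. N))" for w
      using dep[of w, OF _ ext[OF w]] dep[OF _ w, of "\<lambda>i\<in>I. if i \<in> J then restrict w J i else c"] \<open>J \<subseteq> I\<close>
      by (auto simp: subset_eq)
    moreover have "restrict w J \<in> space (PiM J (\<lambda>_. N))" if "w \<in> space (PiM I (\<lambda>_. N))" for w
      using that \<open>J \<subseteq> I\<close> by (auto simp: space_PiM PiE_iff)
    moreover have "w \<in> space (PiM I (\<lambda>_. N))" if "w \<in> A" for w
      using sets.sets_into_space[OF A] that by auto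
    moreover have "space (PiM I (\<lambda>_. N)) = PiE I (\<lambda>i. space (M i))"
      by (simp add: space_PiM sp)
    ultimately show ?thesis
      unfolding prod_emb_def B_def by auto
  qed
  moreover have "B \<in> sets (PiM J M)"
    using B sets_PiM_cong[of J J M "\<lambda>_. N"] M(2) by simp
  ultimately show "measure (PiM I M) A = measure (PiM J M) B"
    using M.emeasure_prod_emb[OF \<open>J \<subseteq> I\<close> \<open>finite I\<close>, of B] by (simp add: measure_def)
qed


lemma gaussian_cylinder_change_of_measure:
  fixes m m' :: "'i \<Rightarrow> real"
  assumes I: "finite I" "J \<subseteq> I" and \<sigma>: "0 < \<sigma>" and s: "0 < s"
    and A: "A \<in> sets (PiM I (\<lambda>_. borel))"
    and dep: "\<And>w w'. w \<in> A \<Longrightarrow> w' \<in> space (PiM I (\<lambda>_. borel)) \<Longrightarrow>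
      (\<And>i. i \<in> J \<Longrightarrow> w i = w' i) \<Longrightarrow> w' \<in> A"
  shows "measure (PiM I (\<lambda>i. gaussian \<sigma> (m' i))) A \<le>
    s / 2 * measure (PiM I (\<lambda>i. gaussian \<sigma> (m i))) A +
    exp (\<Sum>i\<in>J. (m' i - m i)\<^sup>2 / \<sigma>\<^sup>2) / (2 * s)"
proof -
  define B where "B = {v \<in> space (PiM J (\<lambda>_. borel)). (\<lambda>i\<in>I. if i \<in> J then v i else (0::real)) \<in> A}"
  have B: "B \<in> sets (PiM J (\<lambda>_. borel))"
    unfolding B_def
    by (rule measure_PiM_cylinder(1)[OF I _ _ A, where M = "\<lambda>i. gaussian \<sigma> (m i)"])
      (auto simp: prob_space_gaussian \<sigma> intro: dep)
  have cyl: "measure (PiM I (\<lambda>i. gaussian \<sigma> (f i))) A = measure (PiM J (\<lambda>i. gaussian \<sigma> (f i))) B" for f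
    unfolding B_def
    by (rule measure_PiM_cylinder(2)[OF I _ _ A]) (auto simp: prob_space_gaussian \<sigma> intro: dep)
  show ?thesis
    unfolding cyl using I by (intro gaussian_PiM_change_of_measure \<sigma> s B) (rule finite_subset)
qed

definition two_arms :: "real \<Rightarrow> real \<Rightarrow> real \<Rightarrow> nat \<Rightarrow> real measure" where
  "two_arms \<sigma> \<epsilon> x i = gaussian \<sigma> (if i = 0 then x else \<epsilon>)"

lemma lessThan_2: "{..<2::nat} = {0, 1}"
  by auto

lemma best_mean_two_arms: "0 < \<sigma> \<Longrightarrow> best_mean 2 (two_arms \<sigma> \<epsilon> x) = max x \<epsilon>"
  by (simp add: best_mean_def lessThan_2 two_arms_def)

lemma two_arms_in_bandit_models:
  "0 < \<sigma> \<Longrightarrow> x \<in> {0..1} \<Longrightarrow> \<epsilon> \<in> {0..1} \<Longrightarrow> two_arms \<sigma> \<epsilon> x \<in> bandit_models 2 \<sigma>"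
  by (simp add: bandit_models_def two_arms_def subgaussian_gaussian)

lemma Hcomp_two_arms:
  assumes "0 < \<sigma>" "0 < \<epsilon>" "2 * \<epsilon> \<le> x"
  shows "Hcomp 2 \<epsilon> (two_arms \<sigma> \<epsilon> x) = 2 / x\<^sup>2"
proof -
  have "{..<2::nat} - {0} = {1}" by auto
  then have "gap 2 (two_arms \<sigma> \<epsilon> x) i = x - \<epsilon>" if "i < 2" for i
    using that assms
    by (cases "i = 0") (auto simp: gap_def best_mean_two_arms two_arms_def)
  then show ?thesis
    using assms by (simp add: Hcomp_def Nstar_def)
qed

lemma finite_sample_index: "finite (sample_index n T Q)"
proof -
  have "sample_index n T Q \<subseteq> (SIGMA i:{..<n}. SIGMA t:{..<T}. {..<Q i t})"
    by (auto simp: sample_index_def)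
  then show ?thesis
    by (rule finite_subset) simp
qed

lemma sample_space_two_arms:
  "sample_space 2 T Q (two_arms \<sigma> \<epsilon> x) =
    PiM (sample_index 2 T Q) (\<lambda>z. gaussian \<sigma> (if fst z = 0 then x else \<epsilon>))"
  unfolding sample_space_def by (intro PiM_cong) (auto simp: two_arms_def)

lemma sets_sample_space_two_arms:
  "sets (sample_space 2 T Q (two_arms \<sigma> \<epsilon> x)) = sets (borel_sample_space 2 T Q)"
  unfolding sample_space_two_arms borel_sample_space_def by (intro sets_PiM_cong) simp_all

lemma prob_space_sample_space_two_arms:
  "0 < \<sigma> \<Longrightarrow> prob_space (sample_space 2 T Q (two_arms \<sigma> \<epsilon> x))"
  unfolding sample_space_two_arms by (intro prob_space_PiM prob_space_gaussian)

lemma sum_sample_index_arm_0: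
  fixes c :: real
  assumes "V \<subseteq> {..<T}"
  shows "(\<Sum>z\<in>{z \<in> sample_index 2 T Q. fst z = 0 \<longrightarrow> fst (snd z) \<in> V}. if fst z = 0 then c else 0) =
    (\<Sum>t\<in>V. real (Q 0 t)) * c"
proof -
  have V: "finite V" using assms by (rule finite_subset) simp
  let ?J = "{z \<in> sample_index 2 T Q. fst z = 0 \<longrightarrow> fst (snd z) \<in> V}"
  have eq: "{z \<in> ?J. fst z = 0} = Pair 0 ` (SIGMA t:V. {..<Q 0 t})"
    using assms by (auto simp: sample_index_def image_iff)
  have "(\<Sum>z\<in>?J. if fst z = 0 then c else 0) = (\<Sum>z\<in>{z \<in> ?J. fst z = 0}. c)"
    by (rule sum.inter_filter [symmetric]) (simp add: finite_sample_index)
  also have "\<dots> = (\<Sum>t\<in>V. real (Q 0 t)) * c"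
    unfolding eq using V by (simp add: card_image inj_on_def card_SigmaI)
  finally show ?thesis .
qed

text \<open>The event that arm 0 is sampled in no round outside \<open>V\<close> and is recommended is a cylinder over
  the deterministic set of samples of arm 1 and of arm 0 in rounds \<open>V\<close>, so the adaptivity of the
  algorithm plays no role in the change of measure.\<close>

lemma sampled_outside:
  assumes \<sigma>: "0 < \<sigma>" and \<delta>: "0 < \<delta>" "\<delta> \<le> 1/6" and \<epsilon>: "0 < \<epsilon>"
    and alg: "fixed_batch_alg 2 T Q b Ihat" and pac: "is_PAC 2 T Q Ihat \<sigma> \<epsilon> \<delta>"
    and x: "2 * \<epsilon> \<le> x" "x \<le> 1" and V: "V \<subseteq> {..<T}"
    and budget: "(\<Sum>t\<in>V. real (Q 0 t)) * (x\<^sup>2 / \<sigma>\<^sup>2) \<le> ln (1 / (2 * \<delta>)) / 2"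
    and E: "E \<in> sets (borel_sample_space 2 T Q)"
    and prob_E: "measure (sample_space 2 T Q (two_arms \<sigma> \<epsilon> x)) E > 5/6"
  shows "\<exists>w\<in>E. \<exists>t<T. b 0 t w \<and> t \<notin> V"
proof (rule ccontr)
  assume contra: "\<not> ?thesis"
  let ?B = "borel_sample_space 2 T Q" and ?I = "sample_index 2 T Q"
  let ?P = "sample_space 2 T Q (two_arms \<sigma> \<epsilon> x)"
  let ?P' = "sample_space 2 T Q (two_arms \<sigma> \<epsilon> 0)"
  interpret P: prob_space ?P
    by (rule prob_space_sample_space_two_arms[OF \<sigma>])
  interpret P': prob_space ?P'
    by (rule prob_space_sample_space_two_arms[OF \<sigma>])
  have sp: "space ?P = space ?B" "space ?P' = space ?B"
    by (intro sets_eq_imp_space_eq sets_sample_space_two_arms)+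
  have b_meas: "b i t \<in> measurable ?B (count_space UNIV)"
    and b_obs: "\<And>w w'. w \<in> space ?B \<Longrightarrow> w' \<in> space ?B \<Longrightarrow> observed_agree 2 Q b t w w' \<Longrightarrow> b i t w = b i t w'"
    if "i < 2" "t < T" for i t
    using alg that unfolding fixed_batch_alg_def by blast+
  have Ihat_meas [measurable]: "Ihat \<in> measurable ?B (count_space UNIV)"
    and Ihat_obs: "\<And>w w'. w \<in> space ?B \<Longrightarrow> w' \<in> space ?B \<Longrightarrow> observed_agree 2 Q b T w w' \<Longrightarrow> Ihat w = Ihat w'"
    using alg unfolding fixed_batch_alg_def by blast+
  have pac': "measure (sample_space 2 T Q nu)
      {w \<in> space (sample_space 2 T Q nu). arm_mean (nu (Ihat w)) > best_mean 2 nu - \<epsilon>} \<ge> 1 - \<delta>"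
    if "nu \<in> bandit_models 2 \<sigma>" for nu
    using pac that unfolding is_PAC_def by (rule bspec)
  define G where "G = {w \<in> space ?B. Ihat w = 0}"
  define A where "A = {w \<in> space ?B. Ihat w = 0 \<and> (\<forall>t\<in>{..<T}. b 0 t w \<longrightarrow> t \<in> V)}"
  have G_sets: "G \<in> sets ?B"
    unfolding G_def by measurable
  have A_sets: "A \<in> sets ?B"
  proof -
    have "A = G - (\<Union>t\<in>{..<T} - V. b 0 t -` {True} \<inter> space ?B)"
      by (auto simp: A_def G_def)
    also have "\<dots> \<in> sets ?B"
      by (intro sets.Diff sets.finite_UN G_sets measurable_sets[OF b_meas]) auto
    finally show ?thesis .
  qed
  have prob_G: "measure ?P G \<ge> 1 - \<delta>"
  proof -
    have "1 - \<delta> \<le> measure ?P {w \<in> space ?P.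
        arm_mean (two_arms \<sigma> \<epsilon> x (Ihat w)) > best_mean 2 (two_arms \<sigma> \<epsilon> x) - \<epsilon>}"
      using \<sigma> \<epsilon> x by (intro pac' two_arms_in_bandit_models) auto
    also have "{w \<in> space ?P. arm_mean (two_arms \<sigma> \<epsilon> x (Ihat w)) > best_mean 2 (two_arms \<sigma> \<epsilon> x) - \<epsilon>} = G"
      unfolding G_def sp using \<sigma> \<epsilon> x by (auto simp: best_mean_two_arms two_arms_def)
    finally show ?thesis .
  qed
  have prob_A': "measure ?P' A \<le> \<delta>"
  proof -
    have "1 - \<delta> \<le> measure ?P' {w \<in> space ?P'.
        arm_mean (two_arms \<sigma> \<epsilon> 0 (Ihat w)) > best_mean 2 (two_arms \<sigma> \<epsilon> 0) - \<epsilon>}"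
      using \<sigma> \<epsilon> x by (intro pac' two_arms_in_bandit_models) auto
    also have "{w \<in> space ?P'. arm_mean (two_arms \<sigma> \<epsilon> 0 (Ihat w)) > best_mean 2 (two_arms \<sigma> \<epsilon> 0) - \<epsilon>} =
        space ?P' - G"
      unfolding G_def sp using \<sigma> \<epsilon> by (auto simp: best_mean_two_arms two_arms_def)
    finally have "1 - \<delta> \<le> measure ?P' (space ?P' - G)" .
    moreover have "measure ?P' (space ?P' - G) = 1 - measure ?P' G"
      by (rule P'.prob_compl) (simp add: sets_sample_space_two_arms G_sets)
    moreover have "measure ?P' A \<le> measure ?P' G"
      by (rule P'.finite_measure_mono) (auto simp: A_def G_def sets_sample_space_two_arms G_sets[unfolded G_def])
    ultimately show ?thesis by linarith
  qed
  have "2/3 < measure ?P A"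
  proof -
    have "measure ?P (E \<inter> G) \<ge> measure ?P E + measure ?P G - 1"
      using P.finite_measure_Union'[of E G] P.finite_measure_Diff'[of G E] P.prob_le_1[of "E \<union> G"] E G_sets
      by (simp add: sets_sample_space_two_arms Int_commute)
    moreover have "measure ?P (E \<inter> G) \<le> measure ?P A"
      using contra by (intro P.finite_measure_mono) (auto simp: A_def G_def sets_sample_space_two_arms A_sets[unfolded A_def])
    ultimately show ?thesis
      using prob_E prob_G \<delta> by linarith
  qed
  moreover have "measure ?P A \<le> 1 / (2 * \<delta>) / 2 * measure ?P' A +
      exp ((\<Sum>t\<in>V. real (Q 0 t)) * (x\<^sup>2 / \<sigma>\<^sup>2)) / (2 * (1 / (2 * \<delta>)))"
  proof -
    let ?J = "{z \<in> ?I. fst z = 0 \<longrightarrow> fst (snd z) \<in> V}"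
    let ?m = "\<lambda>y z. if fst z = (0::nat) then y else \<epsilon>"
    have dep: "w' \<in> A" if w: "w \<in> A" and w': "w' \<in> space (PiM ?I (\<lambda>_. borel))"
      and eq: "\<And>z. z \<in> ?J \<Longrightarrow> w z = w' z" for w w'
    proof -
      have w_space: "w \<in> space ?B" and w'_space: "w' \<in> space ?B"
        using w w' by (auto simp: A_def borel_sample_space_def)
      have agree: "observed_agree 2 Q b t w w'" if "t \<le> T" for t
        unfolding observed_agree_def
      proof (intro allI impI)
        fix j s k assume *: "j < 2 \<and> s < t \<and> b j s w \<and> k < Q j s"
        then have "(j, s, k) \<in> ?J"
          using w \<open>t \<le> T\<close> by (auto simp: sample_index_def A_def)
        then show "w (j, s, k) = w' (j, s, k)" by (rule eq)
      qed
      have "Ihat w = Ihat w'"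
        using Ihat_obs[OF w_space w'_space] agree by simp
      moreover have "b 0 t w = b 0 t w'" if "t < T" for t
        using b_obs[OF _ that w_space w'_space] agree that by simp
      ultimately show ?thesis
        using w w'_space by (auto simp: A_def)
    qed
    have "measure ?P A \<le> 1 / (2 * \<delta>) / 2 * measure ?P' A +
        exp (\<Sum>z\<in>?J. (?m x z - ?m 0 z)\<^sup>2 / \<sigma>\<^sup>2) / (2 * (1 / (2 * \<delta>)))"
      unfolding sample_space_two_arms
    proof (rule gaussian_cylinder_change_of_measure[OF finite_sample_index _ \<sigma>])
      show "A \<in> sets (PiM ?I (\<lambda>_. borel))"
        using A_sets by (simp add: borel_sample_space_def)
    qed (use \<delta> in simp, use \<delta> in simp, rule dep)
    also have "(\<Sum>z\<in>?J. (?m x z - ?m 0 z)\<^sup>2 / \<sigma>\<^sup>2) = (\<Sum>z\<in>?J. if fst z = 0 then x\<^sup>2 / \<sigma>\<^sup>2 else 0)"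
      by (intro sum.cong refl) simp
    also have "\<dots> = (\<Sum>t\<in>V. real (Q 0 t)) * (x\<^sup>2 / \<sigma>\<^sup>2)"
      by (rule sum_sample_index_arm_0[OF V])
    finally show ?thesis .
  qed
  moreover have "1 / (2 * \<delta>) / 2 * measure ?P' A \<le> 1/4"
    using prob_A' \<delta> by (simp add: field_simps)
  moreover have "exp ((\<Sum>t\<in>V. real (Q 0 t)) * (x\<^sup>2 / \<sigma>\<^sup>2)) / (2 * (1 / (2 * \<delta>))) \<le> 5/12"
  proof -
    define y where "y = \<delta> * exp (ln (1 / (2 * \<delta>)) / 2)"
    have "y\<^sup>2 = \<delta>\<^sup>2 * exp (ln (1 / (2 * \<delta>)))"
      by (simp add: y_def power_mult_distrib exp_double [symmetric])
    also have "\<dots> = \<delta> / 2"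
      using \<delta> by (simp add: power2_eq_square)
    finally have "y\<^sup>2 \<le> (5/12)\<^sup>2"
      using \<delta> by (simp add: power2_eq_square)
    then have "y \<le> 5/12"
      by (rule power2_le_imp_le) simp
    moreover have "\<delta> * exp ((\<Sum>t\<in>V. real (Q 0 t)) * (x\<^sup>2 / \<sigma>\<^sup>2)) \<le> y"
      unfolding y_def using \<delta> budget by (intro mult_left_mono) auto
    ultimately show ?thesis
      using \<delta> by (simp add: mult.commute)
  qed
  ultimately show False by linarith
qed

lemma borel_measurable_Ntilde:
  assumes "fixed_batch_alg n T Q b Ihat"
  shows "Ntilde n T Q b \<in> borel_measurable (borel_sample_space n T Q)"
proof -
  have "(\<lambda>w. if b i t w then real (Q i t) else 0) \<in> borel_measurable (borel_sample_space n T Q)"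
    if "i < n" "t < T" for i t
  proof -
    have [measurable]: "b i t \<in> measurable (borel_sample_space n T Q) (count_space UNIV)"
      using assms that unfolding fixed_batch_alg_def by blast
    show ?thesis by measurable
  qed
  then show ?thesis
    unfolding Ntilde_def [abs_def] by (intro borel_measurable_sum) auto
qed

lemma sum_arm_0_le_Ntilde: "(\<Sum>t\<in>{t. t < T \<and> b 0 t w}. real (Q 0 t)) \<le> Ntilde 2 T Q b w"
proof -
  have "(\<Sum>t\<in>{t. t < T \<and> b 0 t w}. real (Q 0 t)) = (\<Sum>t<T. if b 0 t w then real (Q 0 t) else 0)"
    using sum.inter_filter[of "{..<T}" "\<lambda>t. real (Q 0 t)" "\<lambda>t. b 0 t w"] by simp
  also have "\<dots> \<le> Ntilde 2 T Q b w"
    by (simp add: Ntilde_def lessThan_2 sum_nonneg)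
  finally show ?thesis .
qed


theorem theorem5:
  fixes T :: nat and \<sigma> \<epsilon> \<delta> :: real
    and Q :: "nat \<Rightarrow> nat \<Rightarrow> nat"
    and b :: "nat \<Rightarrow> nat \<Rightarrow> (nat \<times> nat \<times> nat \<Rightarrow> real) \<Rightarrow> bool"
    and Ihat :: "(nat \<times> nat \<times> nat \<Rightarrow> real) \<Rightarrow> nat"
  assumes "T \<ge> 1" and "\<sigma> > 0"
    and "0 < \<delta>" and "\<delta> \<le> 1/6"
    and "0 < \<epsilon>" and "\<epsilon> \<le> 2 powr (- (real T + 1))"
    and "A_tilde 2 T \<sigma> \<epsilon> \<delta> Q b Ihat"
  shows "\<exists>nu \<in> bandit_models 2 \<sigma>.
           measure (sample_space 2 T Q nu)
             {w \<in> space (sample_space 2 T Q nu).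
                Ntilde 2 T Q b w / Hcomp 2 \<epsilon> nu
                  \<ge> \<sigma>\<^sup>2 / 192 * ln (1 / (2 * \<delta>)) * \<epsilon> powr (- 2 / real T)}
           \<ge> 1 / 6"
proof (rule ccontr)
  assume contra: "\<not> ?thesis"
  note T = assms(1) and \<sigma> = assms(2) and \<delta> = assms(3,4) and \<epsilon> = assms(5)
  have alg: "fixed_batch_alg 2 T Q b Ihat" and pac: "is_PAC 2 T Q Ihat \<sigma> \<epsilon> \<delta>"
    using assms(7) by (simp_all add: A_tilde_def)
  define L where "L = ln (1 / (2 * \<delta>))"
  have L: "0 < L"
    unfolding L_def using \<delta> by (intro ln_gt_zero) (simp add: field_simps)
  define q where "q = (2 * \<epsilon>) powr (1 / real T)"
  have q_pos: "0 < q" using \<epsilon> by (simp add: q_def)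
  have eps2: "2 * \<epsilon> \<le> 2 powr (- real T)"
    using assms(6) by (simp add: powr_diff powr_minus powr_add field_simps)
  have q_half: "q \<le> 1/2"
  proof -
    have "q \<le> (2 powr (- real T)) powr (1 / real T)"
      unfolding q_def using eps2 \<epsilon> by (intro powr_mono2) auto
    also have "\<dots> = 1/2"
      unfolding powr_powr using T by (simp add: powr_minus)
    finally show ?thesis .
  qed
  have q_T: "q ^ T = 2 * \<epsilon>"
    unfolding powr_realpow[OF q_pos, symmetric] using T \<epsilon> by (simp add: q_def powr_powr)
  have eps_powr: "\<epsilon> powr (- 2 / real T) \<le> 4 / q\<^sup>2"
  proof -
    have "\<epsilon> powr (- 2 / real T) = (2 * \<epsilon>) powr (- 2 / real T) * 2 powr (2 / real T)"
      using \<epsilon> by (simp add: powr_mult powr_minus divide_inverse)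
    also have "(2 * \<epsilon>) powr (- 2 / real T) = 1 / q\<^sup>2"
    proof -
      have "q\<^sup>2 = (2 * \<epsilon>) powr (2 / real T)"
        unfolding q_def using \<epsilon> by (simp add: power2_eq_square powr_add [symmetric])
      then show ?thesis
        by (simp add: powr_minus divide_inverse)
    qed
    also have "2 powr (2 / real T) \<le> (2::real) powr 2"
      using T by (intro powr_mono) (auto simp: field_simps)
    finally show ?thesis
      using q_pos by (simp add: divide_right_mono mult_left_mono)
  qed
  have "\<exists>V\<subseteq>{..<T}. k \<le> card V \<and> (\<Sum>t\<in>V. real (Q 0 t)) \<le> \<sigma>\<^sup>2 * L / (18 * (q ^ k)\<^sup>2)"
    if "k \<le> T + 1" for k
    using that
  proof (induction k)
    case 0
    show ?case
      using L by (intro exI[of _ "{}"]) simp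
  next
    case (Suc k)
    then obtain V where V: "V \<subseteq> {..<T}" "k \<le> card V"
      and budget: "(\<Sum>t\<in>V. real (Q 0 t)) \<le> \<sigma>\<^sup>2 * L / (18 * (q ^ k)\<^sup>2)"
      by auto
    define x where "x = q ^ k"
    have x: "2 * \<epsilon> \<le> x" "x \<le> 1"
      unfolding x_def q_T [symmetric] using q_pos q_half Suc.prems
      by (auto intro!: power_decreasing power_le_one)
    have x_pos: "0 < x" using q_pos by (simp add: x_def)
    let ?B = "borel_sample_space 2 T Q"
    let ?nu = "two_arms \<sigma> \<epsilon> x"
    let ?P = "sample_space 2 T Q ?nu"
    let ?c = "\<sigma>\<^sup>2 / 192 * L * \<epsilon> powr (- 2 / real T)"
    let ?F = "{w \<in> space ?P. Ntilde 2 T Q b w / Hcomp 2 \<epsilon> ?nu \<ge> ?c}"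
    interpret P: prob_space ?P
      by (rule prob_space_sample_space_two_arms[OF \<sigma>])
    have sp: "space ?P = space ?B"
      by (intro sets_eq_imp_space_eq sets_sample_space_two_arms)
    have F: "?F \<in> sets ?P"
    proof -
      have [measurable]: "Ntilde 2 T Q b \<in> borel_measurable ?B"
        by (rule borel_measurable_Ntilde[OF alg])
      show ?thesis
        unfolding sets_sample_space_two_arms sp by measurable
    qed
    have "?nu \<in> bandit_models 2 \<sigma>"
      using \<sigma> \<epsilon> x by (intro two_arms_in_bandit_models) auto
    then have "measure ?P ?F < 1/6"
      using contra unfolding L_def by (auto simp: not_le)
    then have prob: "measure ?P (space ?P - ?F) > 5/6"
      using P.prob_compl[OF F] by simp
    have "(\<Sum>t\<in>V. real (Q 0 t)) * (x\<^sup>2 / \<sigma>\<^sup>2) \<le> \<sigma>\<^sup>2 * L / (18 * x\<^sup>2) * (x\<^sup>2 / \<sigma>\<^sup>2)"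
      using budget unfolding x_def by (intro mult_right_mono) auto
    also have "\<dots> = L / 18"
      using x_pos \<sigma> by simp
    also have "\<dots> \<le> L / 2"
      using L by simp
    finally have small: "(\<Sum>t\<in>V. real (Q 0 t)) * (x\<^sup>2 / \<sigma>\<^sup>2) \<le> ln (1 / (2 * \<delta>)) / 2"
      unfolding L_def .
    have "space ?P - ?F \<in> sets ?B"
      using sets.compl_sets[OF F] by (simp only: sets_sample_space_two_arms)
    from sampled_outside[OF \<sigma> \<delta> \<epsilon> alg pac x V(1) small this prob]
    obtain w t where w: "w \<in> space ?P - ?F" and t: "t < T" "b 0 t w" "t \<notin> V"
      by blast
    define W where "W = {t. t < T \<and> b 0 t w}"
    have fin: "finite V" "finite W"
      using V(1) by (auto simp: W_def intro: finite_subset)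
    have "card V < card (V \<union> W)"
      using fin t by (intro psubset_card_mono) (auto simp: W_def)
    moreover have "(\<Sum>t\<in>V \<union> W. real (Q 0 t)) \<le> \<sigma>\<^sup>2 * L / (18 * (q ^ Suc k)\<^sup>2)"
    proof -
      have "(\<Sum>t\<in>V \<union> W. real (Q 0 t)) \<le> (\<Sum>t\<in>V. real (Q 0 t)) + (\<Sum>t\<in>W. real (Q 0 t))"
        using fin by (simp add: sum_Un sum_nonneg)
      also have "(\<Sum>t\<in>V. real (Q 0 t)) \<le> \<sigma>\<^sup>2 * L / (72 * (q * x)\<^sup>2)"
      proof -
        have "q\<^sup>2 \<le> (1/2)\<^sup>2"
          using q_half q_pos by (intro power_mono) auto
        then have "72 * (q * x)\<^sup>2 \<le> 18 * x\<^sup>2"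
          using x_pos by (simp add: power_mult_distrib power2_eq_square)
        then have "\<sigma>\<^sup>2 * L / (18 * x\<^sup>2) \<le> \<sigma>\<^sup>2 * L / (72 * (q * x)\<^sup>2)"
          using L q_pos x_pos by (intro divide_left_mono) auto
        then show ?thesis
          using budget by (simp add: x_def)
      qed
      also have "(\<Sum>t\<in>W. real (Q 0 t)) \<le> \<sigma>\<^sup>2 * L / (24 * (q * x)\<^sup>2)"
      proof -
        have "Ntilde 2 T Q b w / (2 / x\<^sup>2) < ?c"
          using w unfolding Hcomp_two_arms[OF \<sigma> \<epsilon> x(1)]
          by (auto simp only: Diff_iff mem_Collect_eq not_le)
        then have "Ntilde 2 T Q b w \<le> ?c * (2 / x\<^sup>2)"
          using x_pos by (simp add: field_simps)
        also have "\<dots> \<le> (\<sigma>\<^sup>2 / 192 * L * (4 / q\<^sup>2)) * (2 / x\<^sup>2)"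
          using eps_powr L by (intro mult_right_mono mult_left_mono) auto
        also have "\<dots> = \<sigma>\<^sup>2 * L / (24 * (q * x)\<^sup>2)"
          by (simp add: power_mult_distrib mult_ac)
        finally show ?thesis
          using sum_arm_0_le_Ntilde[where T = T and b = b and w = w and Q = Q] unfolding W_def by linarith
      qed
      also have "\<sigma>\<^sup>2 * L / (72 * (q * x)\<^sup>2) + \<sigma>\<^sup>2 * L / (24 * (q * x)\<^sup>2) = \<sigma>\<^sup>2 * L / (18 * (q * x)\<^sup>2)"
        using q_pos x_pos by (simp add: field_simps)
      finally show ?thesis
        by (simp add: x_def)
    qed
    ultimately show ?case
      using V by (intro exI[of _ "V \<union> W"]) (auto simp: W_def)
  qed
  from this[of "T + 1"] obtain V where "V \<subseteq> {..<T}" "T + 1 \<le> card V"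
    by auto
  then show False
    using card_mono[of "{..<T}" V] by simp
qed

end
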